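(* For every positive integer $\ell$, $P(2^\ell+1)=2$; that is, $\lim_{n\to\infty}\sqrt[n]{P(n,2^\ell+1)}=2$.
   Context: A permutation of $[n]=\{1,2,\ldots,n\}$ is regarded as a linear ordering (sequence) of the elements of $[n]$. Two permutations of $[n]$ are $k$-neighbor separated if there are two elements of $[n]$ that are neighbors (occupy consecutive positions) in one of the permutations and are separated by exactly $k-2$ other elements in the other permutation (i.e. their positions there differ by exactly $k-1$). $P(n,k)$ denotes the maximal number of pairwise $k$-neighbor separated permutations of $[n]$ (the maximum size of a family in which any two distinct members are $k$-neighbor separated), and $P(k):=\lim_{n\to\infty}\sqrt[n]{P(n,k)}$. *)

theory Defs
  imports Complex_Main "HOL-Combinatorics.Multiset_Permutations"
begin

definition at_distance :: "nat \<Rightarrow> 'a list \<Rightarrow> 'a \<Rightarrow> 'a \<Rightarrow> bool" where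
  "at_distance d xs a b \<longleftrightarrow>
     (\<exists>i j. i < length xs \<and> j < length xs \<and> xs ! i = a \<and> xs ! j = b \<and> (j = i + d \<or> i = j + d))"

(* Being separated by exactly k - 2 other elements is having positions that differ by k - 1;
   the notion is meant for k >= 2, where the subtraction on nat does not truncate. *)
definition neighbor_separated :: "nat \<Rightarrow> 'a list \<Rightarrow> 'a list \<Rightarrow> bool" where
  "neighbor_separated k xs ys \<longleftrightarrow>
     (\<exists>a b. a \<noteq> b \<and>
        (at_distance 1 xs a b \<and> at_distance (k - 1) ys a b \<or>
         at_distance 1 ys a b \<and> at_distance (k - 1) xs a b))"

(* The maximum is over a finite nonempty set: permutations_of_set {1..n} is finite, and F may
   be empty. *)
definition max_separated :: "nat \<Rightarrow> nat \<Rightarrow> nat" where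
  "max_separated n k =
     Max {card F | F. F \<subseteq> permutations_of_set {1..n} \<and> pairwise (neighbor_separated k) F}"

end

theory Submission
  imports Defs
begin

text \<open>
  Put $d = 2^\ell$, so that two permutations are separated when some pair of elements is at distance
  1 in one of them and at distance $d$ in the other.

  The upper bound is a parity argument. Elements at distance 1 have positions of different parity,
  elements at distance $d$ have positions of the same parity, so separated permutations have
  different sets of elements at even positions, and there are at most $2^n$ such sets
  (\<open>max_separated_le\<close>).

  For the lower bound, write a permutation row by row into a grid with $d$ columns: horizontal
  neighbours are at distance 1 and vertical neighbours at distance $d$. The permutations are the
  leaves of a binary decision tree, whose states consist of rectangular blocks of size
  $2^i \times 2^j$ with fixed entries and not yet fixed place in the grid, starting from $n$ single
  cells. Two blocks of the same shape can be glued in two ways, one on top of the other or side by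
  side. If the second block is rotated by 180 degrees for the latter, then the last cell of the first
  block and the top right cell of the second one are vertical neighbours in one outcome and
  horizontal neighbours in the other. All leaves below the first outcome are therefore separated
  from all leaves below the second one. As $d$ is a power of two, repeated gluing
  produces blocks with exactly $d$ columns. Such a block is appended to the part of the permutation
  that is already built, again in two ways: as it is, or with its rows reversed. The old last element
  is at distance $d$ from the top right cell of the block in the first case and at distance 1 in the
  second.

  Every such step gives one binary choice and reduces the number of blocks by one, so that nearly
  $n$ choices can be made. The process stops when the remaining blocks have fewer than $d$ columns
  and pairwise different shapes. To bound their number, heights are restricted to $2^L$. Two blocks
  of that height are only glued side by side, without a choice. To account for this loss, a block of
  height $2^i$ has the weight $w_i = 2 - 2^i / 2^L$. Then $w_i^2 \le w_{i+1} + w_i$ for all $i \le L$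
  (\<open>weight_factor_square\<close>), so the product of the weights of all blocks
  bounds the number of leaves from below, up to a constant for the boundedly many blocks that are
  left at the end (\<open>family_exists\<close>). Those blocks are placed with gaps, which a constant
  number of additional elements fills. With $n$ single cells this gives
  $c\,(2 - 2^{-L})^n$ permutations of $n + O(1)$ elements (\<open>max_separated_ge\<close>), and $L$ is
  arbitrary.
\<close>

section \<open>Rectangular blocks\<close>

definition cells :: "nat \<Rightarrow> nat \<Rightarrow> (nat \<Rightarrow> nat \<Rightarrow> 'a) \<Rightarrow> 'a set" where
  "cells a b E = (\<lambda>(r, c). E r c) ` ({..<a} \<times> {..<b})"

text \<open>
  Gluing and mirroring only have to control which pairs end up at distance 1 or \<open>d\<close>, and not in
  which direction. With absolute values, a block laid out upside down or mirrored still counts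
  as laid out, which is what lets the glued blocks be rotated freely.
\<close>

definition lays_out :: "nat \<Rightarrow> nat \<Rightarrow> nat \<Rightarrow> ('a \<Rightarrow> int) \<Rightarrow> (nat \<Rightarrow> nat \<Rightarrow> 'a) \<Rightarrow> bool" where
  "lays_out d a b p E \<longleftrightarrow>
     (\<forall>r c. r < a \<longrightarrow> Suc c < b \<longrightarrow> \<bar>p (E r c) - p (E r (Suc c))\<bar> = 1) \<and>
     (\<forall>r c. Suc r < a \<longrightarrow> c < b \<longrightarrow> \<bar>p (E r c) - p (E (Suc r) c)\<bar> = int d)"

definition vjoin :: "nat \<Rightarrow> (nat \<Rightarrow> nat \<Rightarrow> 'a) \<Rightarrow> (nat \<Rightarrow> nat \<Rightarrow> 'a) \<Rightarrow> nat \<Rightarrow> nat \<Rightarrow> 'a" where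
  "vjoin a E F = (\<lambda>r c. if r < a then E r c else F (r - a) c)"

text \<open>
  The block \<open>F\<close> is rotated by 180 degrees. This brings its top right cell next to the bottom right
  cell of \<open>E\<close>, the cell that is directly above it in \<open>vjoin a E F\<close>.
\<close>

definition hjoin :: "nat \<Rightarrow> nat \<Rightarrow> (nat \<Rightarrow> nat \<Rightarrow> 'a) \<Rightarrow> (nat \<Rightarrow> nat \<Rightarrow> 'a) \<Rightarrow> nat \<Rightarrow> nat \<Rightarrow> 'a" where
  "hjoin a b E F = (\<lambda>r c. if c < b then E r c else F (a - 1 - r) (2 * b - 1 - c))"

definition mirror :: "nat \<Rightarrow> (nat \<Rightarrow> nat \<Rightarrow> 'a) \<Rightarrow> nat \<Rightarrow> nat \<Rightarrow> 'a" where
  "mirror b E = (\<lambda>r c. E r (b - 1 - c))"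

lemma mem_cells: "x \<in> cells a b E \<longleftrightarrow> (\<exists>r<a. \<exists>c<b. x = E r c)"
  by (auto simp: cells_def)

lemma cellsI: "r < a \<Longrightarrow> c < b \<Longrightarrow> E r c \<in> cells a b E"
  by (auto simp: cells_def)

lemma finite_cells: "finite (cells a b E)"
  by (simp add: cells_def)

lemma cells_vjoin: "cells (2 * a) b (vjoin a E F) = cells a b E \<union> cells a b F"
proof (intro set_eqI iffI)
  fix x assume "x \<in> cells a b E \<union> cells a b F"
  then show "x \<in> cells (2 * a) b (vjoin a E F)"
  proof
    assume "x \<in> cells a b E"
    then obtain r c where "r < a" "c < b" "x = E r c" by (auto simp: mem_cells)
    then show ?thesis unfolding mem_cells
      by (intro exI[of _ r] conjI exI[of _ c]) (auto simp: vjoin_def)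
  next
    assume "x \<in> cells a b F"
    then obtain r c where "r < a" "c < b" "x = F r c" by (auto simp: mem_cells)
    then show ?thesis unfolding mem_cells
      by (intro exI[of _ "r + a"] conjI exI[of _ c]) (auto simp: vjoin_def)
  qed
next
  fix x assume "x \<in> cells (2 * a) b (vjoin a E F)"
  then obtain r c where rc: "r < 2 * a" "c < b" "x = vjoin a E F r c" by (auto simp: mem_cells)
  show "x \<in> cells a b E \<union> cells a b F"
  proof (cases "r < a")
    case True
    then show ?thesis using rc by (auto simp: vjoin_def intro: cellsI)
  next
    case False
    then have "r - a < a" using rc by simp
    then show ?thesis using rc False by (auto simp: vjoin_def intro: cellsI)
  qed
qed

lemma cells_hjoin: "cells a (2 * b) (hjoin a b E F) = cells a b E \<union> cells a b F"
proof (intro set_eqI iffI)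
  fix x assume "x \<in> cells a b E \<union> cells a b F"
  then show "x \<in> cells a (2 * b) (hjoin a b E F)"
  proof
    assume "x \<in> cells a b E"
    then obtain r c where "r < a" "c < b" "x = E r c" by (auto simp: mem_cells)
    then show ?thesis unfolding mem_cells
      by (intro exI[of _ r] conjI exI[of _ c]) (auto simp: hjoin_def)
  next
    assume "x \<in> cells a b F"
    then obtain r c where "r < a" "c < b" "x = F r c" by (auto simp: mem_cells)
    then show ?thesis unfolding mem_cells
      by (intro exI[of _ "a - 1 - r"] conjI exI[of _ "2 * b - 1 - c"]) (auto simp: hjoin_def)
  qed
next
  fix x assume "x \<in> cells a (2 * b) (hjoin a b E F)"
  then obtain r c where rc: "r < a" "c < 2 * b" "x = hjoin a b E F r c" by (auto simp: mem_cells)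
  show "x \<in> cells a b E \<union> cells a b F"
  proof (cases "c < b")
    case True
    then show ?thesis using rc by (auto simp: hjoin_def intro: cellsI)
  next
    case False
    then have "a - 1 - r < a" "2 * b - 1 - c < b" using rc by auto
    then show ?thesis using rc False by (auto simp: hjoin_def intro: cellsI)
  qed
qed

lemma cells_mirror: "cells a b (mirror b E) = cells a b E"
proof (intro set_eqI iffI)
  fix x assume "x \<in> cells a b (mirror b E)"
  then obtain r c where "r < a" "c < b" "x = E r (b - 1 - c)" by (auto simp: mem_cells mirror_def)
  then show "x \<in> cells a b E" by (auto intro: cellsI)
next
  fix x assume "x \<in> cells a b E"
  then obtain r c where "r < a" "c < b" "x = E r c" by (auto simp: mem_cells)
  then show "x \<in> cells a b (mirror b E)" unfolding mem_cells
    by (intro exI[of _ r] conjI exI[of _ "b - 1 - c"]) (auto simp: mirror_def)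
qed

lemma lays_out_row: "lays_out d a b p E \<Longrightarrow> r < a \<Longrightarrow> Suc c < b \<Longrightarrow> \<bar>p (E r c) - p (E r (Suc c))\<bar> = 1"
  by (auto simp: lays_out_def)

lemma lays_out_column:
  "lays_out d a b p E \<Longrightarrow> Suc r < a \<Longrightarrow> c < b \<Longrightarrow> \<bar>p (E r c) - p (E (Suc r) c)\<bar> = int d"
  by (auto simp: lays_out_def)

lemma lays_out_cong:
  assumes "\<And>x. x \<in> cells a b E \<Longrightarrow> p x = q x" "lays_out d a b q E"
  shows "lays_out d a b p E"
  using assms(2) by (simp add: lays_out_def assms(1) cellsI)

lemma lays_out_mirror:
  assumes "lays_out d a b p (mirror b E)"
  shows "lays_out d a b p E"
  unfolding lays_out_def
proof (intro conjI allI impI)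
  fix r c assume rc: "r < a" "Suc c < b"
  then have e: "b - 1 - (b - 2 - c) = Suc c" "b - 1 - Suc (b - 2 - c) = c" "Suc (b - 2 - c) < b"
    by linarith+
  show "\<bar>p (E r c) - p (E r (Suc c))\<bar> = 1"
    using lays_out_row[OF assms rc(1) e(3)] unfolding mirror_def e by linarith
next
  fix r c assume "Suc r < a" "c < b"
  then show "\<bar>p (E r c) - p (E (Suc r) c)\<bar> = int d"
    using lays_out_column[OF assms, of r "b - 1 - c"] by (simp add: mirror_def)
qed

text \<open>
  The pair in the last statement is the one that tells the two ways of gluing apart: it is
  at distance \<open>d\<close> here, and at distance 1 after gluing side by side.
\<close>

lemma lays_out_vjoin:
  assumes "lays_out d (2 * a) b p (vjoin a E F)" "a > 0" "b > 0"
  shows "lays_out d a b p E" "lays_out d a b p F"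
    "\<bar>p (E (a - 1) (b - 1)) - p (F 0 (b - 1))\<bar> = int d"
proof -
  show "lays_out d a b p E" unfolding lays_out_def
  proof (intro conjI allI impI)
    fix r c assume "r < a" "Suc c < b"
    then show "\<bar>p (E r c) - p (E r (Suc c))\<bar> = 1"
      using lays_out_row[OF assms(1), of r c] by (simp add: vjoin_def)
  next
    fix r c assume "Suc r < a" "c < b"
    then show "\<bar>p (E r c) - p (E (Suc r) c)\<bar> = int d"
      using lays_out_column[OF assms(1), of r c] by (simp add: vjoin_def)
  qed
  show "lays_out d a b p F" unfolding lays_out_def
  proof (intro conjI allI impI)
    fix r c assume "r < a" "Suc c < b"
    then show "\<bar>p (F r c) - p (F r (Suc c))\<bar> = 1"
      using lays_out_row[OF assms(1), of "a + r" c] by (simp add: vjoin_def)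
  next
    fix r c assume "Suc r < a" "c < b"
    then show "\<bar>p (F r c) - p (F (Suc r) c)\<bar> = int d"
      using lays_out_column[OF assms(1), of "a + r" c] by (simp add: vjoin_def)
  qed
  show "\<bar>p (E (a - 1) (b - 1)) - p (F 0 (b - 1))\<bar> = int d"
    using lays_out_column[OF assms(1), of "a - 1" "b - 1"] assms(2,3) by (simp add: vjoin_def)
qed

lemma lays_out_hjoin:
  assumes "lays_out d a (2 * b) p (hjoin a b E F)" "a > 0" "b > 0"
  shows "lays_out d a b p E" "lays_out d a b p F"
    "\<bar>p (E (a - 1) (b - 1)) - p (F 0 (b - 1))\<bar> = 1"
proof -
  show "lays_out d a b p E" unfolding lays_out_def
  proof (intro conjI allI impI)
    fix r c assume "r < a" "Suc c < b"
    then show "\<bar>p (E r c) - p (E r (Suc c))\<bar> = 1"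
      using lays_out_row[OF assms(1), of r c] by (simp add: hjoin_def)
  next
    fix r c assume "Suc r < a" "c < b"
    then show "\<bar>p (E r c) - p (E (Suc r) c)\<bar> = int d"
      using lays_out_column[OF assms(1), of r c] by (simp add: hjoin_def)
  qed
  show "lays_out d a b p F" unfolding lays_out_def
  proof (intro conjI allI impI)
    fix r c assume rc: "r < a" "Suc c < b"
    then have e: "\<not> 2 * b - 2 - c < b" "\<not> Suc (2 * b - 2 - c) < b"
      "2 * b - 1 - (2 * b - 2 - c) = Suc c" "2 * b - 1 - Suc (2 * b - 2 - c) = c"
      "a - 1 - (a - 1 - r) = r" and le: "a - 1 - r < a" "Suc (2 * b - 2 - c) < 2 * b"
      by linarith+
    show "\<bar>p (F r c) - p (F r (Suc c))\<bar> = 1"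
      using lays_out_row[OF assms(1) le] unfolding hjoin_def if_not_P[OF e(1)] if_not_P[OF e(2)] e(3-5) by linarith
  next
    fix r c assume rc: "Suc r < a" "c < b"
    then have e: "a - 1 - (a - 2 - r) = Suc r" "a - 1 - Suc (a - 2 - r) = r"
      "2 * b - 1 - (2 * b - 1 - c) = c" "\<not> 2 * b - 1 - c < b"
      and le: "Suc (a - 2 - r) < a" "2 * b - 1 - c < 2 * b" by linarith+
    show "\<bar>p (F r c) - p (F (Suc r) c)\<bar> = int d"
      using lays_out_column[OF assms(1) le] unfolding hjoin_def if_not_P[OF e(4)] e(1-3) by linarith
  qed
  show "\<bar>p (E (a - 1) (b - 1)) - p (F 0 (b - 1))\<bar> = 1"
    using lays_out_row[OF assms(1), of "a - 1" "b - 1"] assms(2,3)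
    by (simp add: hjoin_def mult_2)
qed

text \<open>
  The block starts at position \<open>M\<close>, after all positions of \<open>X\<close>. A block that is narrower than \<open>d\<close> leaves gaps in its
  rows, whence the bound \<open>M + a * d\<close> also in this case.
\<close>

lemma append_block:
  fixes p0 :: "'a \<Rightarrow> int"
  assumes inj: "inj_on p0 X" and ran: "p0 ` X \<subseteq> {0..<int M}"
    and dj: "X \<inter> cells a b E = {}" and cd: "card (cells a b E) = a * b" and bd: "b \<le> d"
  shows "\<exists>p. (\<forall>x\<in>X. p x = p0 x) \<and> (\<forall>r<a. \<forall>c<b. p (E r c) = int (M + r * d + c)) \<and>
    inj_on p (X \<union> cells a b E) \<and> p ` (X \<union> cells a b E) \<subseteq> {0..<int (M + a * d)} \<and>
    lays_out d a b p E"
proof -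
  let ?g = "{..<a} \<times> {..<b}"
  have injE: "inj_on (\<lambda>(r, c). E r c) ?g"
    by (rule eq_card_imp_inj_on) (use cd in \<open>auto simp: cells_def\<close>)
  define p where "p = (\<lambda>x. if x \<in> X then p0 x
    else (case inv_into ?g (\<lambda>(r, c). E r c) x of (r, c) \<Rightarrow> int (M + r * d + c)))"
  have pX: "p x = p0 x" if "x \<in> X" for x using that by (simp add: p_def)
  have pE: "p (E r c) = int (M + r * d + c)" if "r < a" "c < b" for r c
  proof -
    have "E r c \<notin> X" using dj cellsI[OF that, of E] by blast
    moreover have "inv_into ?g (\<lambda>(r, c). E r c) (E r c) = (r, c)"
      using inv_into_f_f[OF injE, of "(r, c)"] that by simp
    ultimately show ?thesis by (simp add: p_def)
  qed
  have bound: "r * d + c < a * d" if "r < a" "c < b" for r c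
  proof -
    have "r * d + c < Suc r * d" using that bd by simp
    also have "\<dots> \<le> a * d" using that by (intro mult_right_mono) auto
    finally show ?thesis .
  qed
  have lo: "p ` X \<subseteq> {0..<int M}" using ran pX by auto
  have hi: "p ` cells a b E \<subseteq> {int M..<int (M + a * d)}"
  proof
    fix y assume "y \<in> p ` cells a b E"
    then obtain r c where "r < a" "c < b" "y = p (E r c)" by (auto simp: mem_cells)
    then show "y \<in> {int M..<int (M + a * d)}" using pE bound[of r c] by (simp flip: of_nat_add of_nat_mult)
  qed
  have injX: "inj_on p X" using inj pX by (metis inj_on_cong)
  have injc: "inj_on p (cells a b E)"
  proof (rule inj_onI)
    fix x y assume "x \<in> cells a b E" "y \<in> cells a b E" and eq: "p x = p y"
    then obtain r c r' c' where xy: "r < a" "c < b" "x = E r c" "r' < a" "c' < b" "y = E r' c'"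
      by (auto simp: mem_cells)
    then have e: "r * d + c = r' * d + c'" using eq pE by (simp flip: of_nat_add of_nat_mult)
    have "c < d" "c' < d" using xy bd by auto
    then have "r = r'" "c = c'"
      using arg_cong[OF e, of "\<lambda>z. z div d"] arg_cong[OF e, of "\<lambda>z. z mod d"] by auto
    then show "x = y" using xy by simp
  qed
  have "inj_on p (X \<union> cells a b E)"
    unfolding inj_on_Un using injX injc lo hi by fastforce
  moreover have "p ` (X \<union> cells a b E) \<subseteq> {0..<int (M + a * d)}"
  proof -
    have "{0..<int M} \<subseteq> {0..<int (M + a * d)}" "{int M..<int (M + a * d)} \<subseteq> {0..<int (M + a * d)}"
      by auto
    then show ?thesis using lo hi unfolding image_Un by blast
  qed
  moreover have "lays_out d a b p E"
    unfolding lays_out_def by (auto simp: pE)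
  ultimately show ?thesis using pX pE by blast
qed

section \<open>Placements and states of the decision tree\<close>

text \<open>
  Elements get positions by an injection, since partial permutations and permutations with gaps
  occur on the way. The set \<open>X\<close> contains the elements that have a position; elsewhere the
  values are arbitrary.
\<close>

definition separates :: "nat \<Rightarrow> 'a set \<Rightarrow> ('a \<Rightarrow> int) \<Rightarrow> ('a \<Rightarrow> int) \<Rightarrow> bool" where
  "separates d X p q \<longleftrightarrow> (\<exists>x\<in>X. \<exists>y\<in>X.
     \<bar>p x - p y\<bar> = 1 \<and> \<bar>q x - q y\<bar> = int d \<or> \<bar>p x - p y\<bar> = int d \<and> \<bar>q x - q y\<bar> = 1)"

lemma separates_sym: "separates d X p q \<Longrightarrow> separates d X q p"
  unfolding separates_def by blast

lemma separates_irrefl: "d \<noteq> 1 \<Longrightarrow> \<not> separates d X p p"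
  unfolding separates_def by auto

lemma separated_union:
  assumes "d \<noteq> 1" "finite G" "finite H"
    and "pairwise (separates d X) G" "pairwise (separates d X) H"
    and cross: "\<And>p q. p \<in> G \<Longrightarrow> q \<in> H \<Longrightarrow> separates d X p q"
  shows "pairwise (separates d X) (G \<union> H)" "card (G \<union> H) = card G + card H"
proof -
  show "pairwise (separates d X) (G \<union> H)"
  proof (rule pairwiseI)
    fix p q assume "p \<in> G \<union> H" "q \<in> G \<union> H" "p \<noteq> q"
    then show "separates d X p q"
      using pairwiseD[OF assms(4), of p q] pairwiseD[OF assms(5), of p q] cross[of p q]
        separates_sym[OF cross[of q p]] by blast
  qed
  have "G \<inter> H = {}" using cross separates_irrefl[OF assms(1)] by blast
  then show "card (G \<union> H) = card G + card H" using assms(2,3) by (simp add: card_Un_disjoint)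
qed

text \<open>
  The triple $(i, j, E)$ stands for a block with $2^i$ rows and $2^j$ columns.
\<close>

type_synonym 'a block = "nat \<times> nat \<times> (nat \<Rightarrow> nat \<Rightarrow> 'a)"

definition bcells :: "'a block \<Rightarrow> 'a set" where
  "bcells = (\<lambda>(i, j, E). cells (2 ^ i) (2 ^ j) E)"

definition covered :: "'a block set \<Rightarrow> 'a set" where
  "covered K = (\<Union>B\<in>K. bcells B)"

text \<open>
  In a state, the elements of \<open>X\<close> have their final positions and those of the blocks in \<open>K\<close> do not.
  The cardinality condition says that the entries of a block are distinct; cardinalities
  simply add up when blocks are glued.
\<close>

definition valid_blocks :: "nat \<Rightarrow> nat \<Rightarrow> 'a set \<Rightarrow> 'a block set \<Rightarrow> bool" where
  "valid_blocks l L X K \<longleftrightarrow> finite K \<and>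
     (\<forall>(i, j, E)\<in>K. i \<le> L \<and> j \<le> l \<and> card (cells (2 ^ i) (2 ^ j) E) = 2 ^ i * 2 ^ j) \<and>
     pairwise (\<lambda>A B. disjnt (bcells A) (bcells B)) K \<and> disjnt X (covered K)"

text \<open>
  Such a \<open>p\<close> completes the partial placement \<open>p0\<close> of \<open>X\<close> in a way that is compatible with all blocks
  of the state.
\<close>

definition placement ::
    "nat \<Rightarrow> 'a block set \<Rightarrow> 'a set \<Rightarrow> ('a \<Rightarrow> int) \<Rightarrow> nat \<Rightarrow> ('a \<Rightarrow> int) \<Rightarrow> bool" where
  "placement l K X p0 M p \<longleftrightarrow> (\<forall>x\<in>X. p x = p0 x) \<and> inj_on p (X \<union> covered K) \<and>
     p ` (X \<union> covered K) \<subseteq> {0..<int M} \<and>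
     (\<forall>(i, j, E)\<in>K. lays_out (2 ^ l) (2 ^ i) (2 ^ j) p E)"

definition weight :: "nat \<Rightarrow> 'a block set \<Rightarrow> real" where
  "weight L K = (\<Prod>(i, j, E)\<in>K. 2 - 2 ^ i / 2 ^ L)"

lemma finite_bcells: "finite (bcells B)"
  by (auto simp: bcells_def finite_cells split: prod.split)

lemma finite_covered: "finite K \<Longrightarrow> finite (covered K)"
  by (auto simp: covered_def finite_bcells)

lemma covered_insert: "covered (insert B K) = bcells B \<union> covered K"
  by (auto simp: covered_def)

lemma validD:
  assumes "valid_blocks l L X K" "(i, j, E) \<in> K"
  shows "i \<le> L" "j \<le> l" "card (cells (2 ^ i) (2 ^ j) E) = 2 ^ i * 2 ^ j"
  using assms by (auto simp: valid_blocks_def)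

lemma valid_disjnt:
  "valid_blocks l L X K \<Longrightarrow> A \<in> K \<Longrightarrow> B \<in> K \<Longrightarrow> A \<noteq> B \<Longrightarrow> disjnt (bcells A) (bcells B)"
  by (simp add: valid_blocks_def pairwise_def)

lemma valid_insertD:
  assumes "valid_blocks l L X (insert B K)" "B \<notin> K"
  shows "valid_blocks l L X K" "valid_blocks l L (X \<union> bcells B) K" "bcells B \<inter> covered K = {}"
    "X \<inter> bcells B = {}"
proof -
  show *: "bcells B \<inter> covered K = {}"
    using assms by (fastforce simp: valid_blocks_def covered_def pairwise_insert disjnt_def)
  show "X \<inter> bcells B = {}"
    using assms by (auto simp: valid_blocks_def covered_insert disjnt_def)
  show "valid_blocks l L X K" using assms(1)
    by (auto simp: valid_blocks_def pairwise_insert covered_insert disjnt_def)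
  then show "valid_blocks l L (X \<union> bcells B) K" using *
    by (auto simp: valid_blocks_def disjnt_def)
qed

lemma int_range_mono: "m \<le> n \<Longrightarrow> {0..<int m} \<subseteq> {0..<int n}"
  by auto

text \<open>
  Each block gets a strip of $2^L$ full rows, without any choice. This is wasteful and is only used
  when few blocks remain.
\<close>

lemma place_leftover:
  assumes "finite K" "valid_blocks l L X K" "inj_on p0 X" "p0 ` X \<subseteq> {0..<int M}"
  shows "\<exists>p. placement l K X p0 (M + card K * (2 ^ L * 2 ^ l)) p"
  using assms
proof (induction K)
  case empty
  then show ?case by (auto simp: placement_def covered_def)
next
  case (insert B K)
  obtain i j E where B: "B = (i, j, E)" by (cases B)
  note v = valid_insertD[OF insert.prems(1) insert.hyps(2)]
  have ij: "i \<le> L" "j \<le> l" and cd: "card (cells (2 ^ i) (2 ^ j) E) = 2 ^ i * 2 ^ j"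
    using validD[OF insert.prems(1), of i j E] B by auto
  obtain p where p: "placement l K X p0 (M + card K * (2 ^ L * 2 ^ l)) p"
    using insert.IH[OF v(1) insert.prems(2,3)] by blast
  let ?M = "M + card K * (2 ^ L * 2 ^ l)"
  have "inj_on p (X \<union> covered K)" "p ` (X \<union> covered K) \<subseteq> {0..<int ?M}"
    "(X \<union> covered K) \<inter> cells (2 ^ i) (2 ^ j) E = {}" "(2::nat) ^ j \<le> 2 ^ l"
    using p v(3,4) ij by (auto simp: placement_def B bcells_def)
  from append_block[OF this(1-3) cd this(4)] obtain q where q:
    "\<forall>x\<in>X \<union> covered K. q x = p x"
    "inj_on q (X \<union> covered K \<union> cells (2 ^ i) (2 ^ j) E)"
    "q ` (X \<union> covered K \<union> cells (2 ^ i) (2 ^ j) E) \<subseteq> {0..<int (?M + 2 ^ i * 2 ^ l)}"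
    "lays_out (2 ^ l) (2 ^ i) (2 ^ j) q E" by blast
  have eq: "X \<union> covered (insert B K) = X \<union> covered K \<union> cells (2 ^ i) (2 ^ j) E"
    by (auto simp: covered_insert B bcells_def)
  have "?M + 2 ^ i * 2 ^ l \<le> M + card (insert B K) * (2 ^ L * 2 ^ l)"
    using insert.hyps ij by simp
  then have "{0..<int (?M + 2 ^ i * 2 ^ l)} \<subseteq> {0..<int (M + card (insert B K) * (2 ^ L * 2 ^ l))}"
    by (rule int_range_mono)
  then have r: "q ` (X \<union> covered (insert B K)) \<subseteq> {0..<int (M + card (insert B K) * (2 ^ L * 2 ^ l))}"
    using q(3) unfolding eq by (rule order_trans[rotated])
  have s: "lays_out (2 ^ l) (2 ^ i') (2 ^ j') q E'" if "(i', j', E') \<in> K" for i' j' E'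
  proof (rule lays_out_cong)
    show "lays_out (2 ^ l) (2 ^ i') (2 ^ j') p E'" using p that by (auto simp: placement_def)
    show "q x = p x" if "x \<in> cells (2 ^ i') (2 ^ j') E'" for x
      using q(1) that \<open>(i', j', E') \<in> K\<close> by (force simp: covered_def bcells_def)
  qed
  have t: "\<forall>x\<in>X. q x = p0 x" using p q(1) by (auto simp: placement_def)
  have "placement l (insert B K) X p0 (M + card (insert B K) * (2 ^ L * 2 ^ l)) q"
    unfolding placement_def using t q(2) r q(4) s B unfolding eq by auto
  then show ?case by blast
qed

lemma valid_merge:
  assumes v: "valid_blocks l L X (insert (i, j, E) (insert (i, j, F) K))"
    and new: "(i, j, E) \<noteq> (i, j, F)" "(i, j, E) \<notin> K" "(i, j, F) \<notin> K"
    and shape: "i' \<le> L" "j' \<le> l" "i' + j' = Suc (i + j)"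
    and J: "cells (2 ^ i') (2 ^ j') J = cells (2 ^ i) (2 ^ j) E \<union> cells (2 ^ i) (2 ^ j) F"
  shows "valid_blocks l L X (insert (i', j', J) K)" "(i', j', J) \<notin> K"
    "covered (insert (i', j', J) K) = covered (insert (i, j, E) (insert (i, j, F) K))"
proof -
  have bJ: "bcells (i', j', J) = bcells (i, j, E) \<union> bcells (i, j, F)"
    using J by (simp add: bcells_def)
  show cov: "covered (insert (i', j', J) K) = covered (insert (i, j, E) (insert (i, j, F) K))"
    by (auto simp: covered_insert bJ)
  have dj: "cells (2 ^ i) (2 ^ j) E \<inter> cells (2 ^ i) (2 ^ j) F = {}"
    using v new by (auto simp: valid_blocks_def pairwise_insert disjnt_def bcells_def)
  have cE: "card (cells (2 ^ i) (2 ^ j) E) = 2 ^ i * 2 ^ j"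
    "card (cells (2 ^ i) (2 ^ j) F) = 2 ^ i * 2 ^ j"
    using v by (auto simp: valid_blocks_def)
  then have "card (cells (2 ^ i') (2 ^ j') J) = 2 ^ (Suc (i + j))"
    unfolding J using dj by (simp add: card_Un_disjoint finite_cells power_add)
  then have cJ: "card (cells (2 ^ i') (2 ^ j') J) = 2 ^ i' * 2 ^ j'"
    by (simp flip: shape(3) add: power_add)
  have dK: "disjnt (bcells (i', j', J)) (bcells B)" if "B \<in> K" for B
  proof -
    have "disjnt (bcells (i, j, E)) (bcells B)" "disjnt (bcells (i, j, F)) (bcells B)"
      using new that by (intro valid_disjnt[OF v]; auto)+
    then show ?thesis by (auto simp: bJ disjnt_def)
  qed
  show "(i', j', J) \<notin> K"
  proof
    assume "(i', j', J) \<in> K"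
    then have "bcells (i', j', J) = {}" using dK by fastforce
    then show False using cJ by (simp add: bcells_def)
  qed
  have "disjnt (bcells B) (bcells (i', j', J))" if "B \<in> K" for B
    using dK[OF that] by (rule disjnt_sym)
  then show "valid_blocks l L X (insert (i', j', J) K)"
    using v shape(1,2) cJ dK cov
    by (simp add: valid_blocks_def pairwise_insert)
qed

section \<open>Counting the leaves of the decision tree\<close>

text \<open>
  If no two blocks have the same shape, there are at most as many blocks as shapes.
\<close>

lemma leftover_card_le:
  assumes "valid_blocks l L X K" and "\<And>i j E. (i, j, E) \<in> K \<Longrightarrow> j < l"
    and distinct: "\<And>i j E F. (i, j, E) \<in> K \<Longrightarrow> (i, j, F) \<in> K \<Longrightarrow> E = F"
  shows "card K \<le> (L + 1) * l"
proof -
  let ?shape = "\<lambda>(i, j, E). (i, j)"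
  have "inj_on ?shape K" using distinct by (auto simp: inj_on_def)
  then have "card K = card (?shape ` K)" by (simp add: card_image)
  also have "\<dots> \<le> card ({..L} \<times> {..<l})"
  proof (intro card_mono subsetI)
    fix s assume "s \<in> ?shape ` K"
    then obtain i j E where "(i, j, E) \<in> K" "s = (i, j)" by auto
    then show "s \<in> {..L} \<times> {..<l}" using validD(1)[OF assms(1)] assms(2) by blast
  qed simp
  finally show ?thesis by simp
qed

lemma weight_factor_bounds:
  assumes "i \<le> L"
  shows "1 \<le> 2 - 2 ^ i / (2 ^ L :: real)" "2 - 2 ^ i / (2 ^ L :: real) \<le> 2"
  using assms by (auto simp: field_simps)

lemma weight_nonneg_le:
  assumes "valid_blocks l L X K"
  shows "0 \<le> weight L K" "weight L K \<le> 2 ^ card K"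
proof -
  have *: "0 \<le> (case B of (i, j, E) \<Rightarrow> 2 - 2 ^ i / (2 ^ L :: real)) \<and>
      (case B of (i, j, E) \<Rightarrow> 2 - 2 ^ i / (2 ^ L :: real)) \<le> 2" if "B \<in> K" for B
  proof -
    obtain i j E where B: "B = (i, j, E)" by (cases B)
    then have "i \<le> L" using validD(1)[OF assms, of i j E] that by simp
    from weight_factor_bounds[OF this] show ?thesis unfolding B prod.case by linarith
  qed
  then show "0 \<le> weight L K" unfolding weight_def by (intro prod_nonneg) blast
  have "weight L K \<le> (\<Prod>B\<in>K. 2)" unfolding weight_def by (intro prod_mono *)
  then show "weight L K \<le> 2 ^ card K" by simp
qed

lemma weight_insert:
  "finite K \<Longrightarrow> (i, j, E) \<notin> K \<Longrightarrow> weight L (insert (i, j, E) K) = (2 - 2 ^ i / 2 ^ L) * weight L K"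
  by (simp add: weight_def)

text \<open>
  Gluing replaces two factors \<open>w i\<close> by either \<open>w (i + 1)\<close> or \<open>w i\<close>, as only one of the two ways of
  gluing increases the height. With \<open>w i = 2 - t\<close> the claim is $t^2 \le t$.
\<close>

lemma weight_factor_square:
  "(2 - 2 ^ i / 2 ^ L) * (2 - 2 ^ i / 2 ^ L) \<le> (2 - 2 ^ Suc i / 2 ^ L) + (2 - 2 ^ i / (2 ^ L :: real))"
  if "i \<le> L"
proof -
  define t :: real where "t = 2 ^ i / 2 ^ L"
  have t: "0 \<le> t" "t \<le> 1" using that by (auto simp: t_def field_simps)
  then have "t * t \<le> 1 * t" by (intro mult_right_mono) auto
  moreover have "2 ^ Suc i / 2 ^ L = 2 * t" by (simp add: t_def)
  ultimately show ?thesis by (simp add: t_def[symmetric] algebra_simps)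
qed

text \<open>
  The number of shapes that can be left over, times the size of the strip that each of them gets.
\<close>

definition waste :: "nat \<Rightarrow> nat \<Rightarrow> nat" where
  "waste l L = (L + 1) * l * (2 ^ L * 2 ^ l)"

definition separated_family :: "nat \<Rightarrow> nat \<Rightarrow> 'a block set \<Rightarrow> 'a set \<Rightarrow> ('a \<Rightarrow> int) \<Rightarrow> nat \<Rightarrow> ('a \<Rightarrow> int) set \<Rightarrow> bool" where
  "separated_family l L K X p0 M G \<longleftrightarrow> finite G \<and>
     (\<forall>p\<in>G. placement l K X p0 (M + card (covered K) + waste l L) p) \<and>
     pairwise (separates (2 ^ l) (X \<union> covered K)) G \<and>
     weight L K / 2 ^ ((L + 1) * l) \<le> real (card G)"

lemma placement_merge:
  assumes p: "placement l (insert (i', j', J) K) X p0 M p"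
    and "lays_out (2 ^ l) (2 ^ i) (2 ^ j) p E" "lays_out (2 ^ l) (2 ^ i) (2 ^ j) p F"
    and "covered (insert (i', j', J) K) = covered (insert (i, j, E) (insert (i, j, F) K))"
  shows "placement l (insert (i, j, E) (insert (i, j, F) K)) X p0 M p"
  using p assms(2-4) by (simp add: placement_def)

text \<open>
  The induction is on the number of blocks. The last occupied position has to be \<open>M - 1\<close>, because
  the element there is the one that distinguishes the two orientations of a block of full width
  appended after it.
\<close>

lemma family_exists:
  assumes "l \<ge> 1" "valid_blocks l L X K" "inj_on p0 X" "p0 ` X \<subseteq> {0..<int M}" "int M - 1 \<in> p0 ` X"
  shows "\<exists>G. separated_family l L K X p0 M G"
  using assms(2-)
proof (induction "card K" arbitrary: K X p0 M rule: less_induct)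
  case (less K X p0 M)
  have d: "(2::nat) ^ l \<noteq> 1" using assms(1) by simp
  have finK: "finite K" using less.prems(1) by (simp add: valid_blocks_def)
  consider (full) i E where "(i, l, E) \<in> K"
    | (twins) i j E F where "(i, j, E) \<in> K" "(i, j, F) \<in> K" "E \<noteq> F" "j < l"
    | (leftover) "\<And>i j E. (i, j, E) \<in> K \<Longrightarrow> j < l"
        "\<And>i j E F. (i, j, E) \<in> K \<Longrightarrow> (i, j, F) \<in> K \<Longrightarrow> E = F"
    using validD(2)[OF less.prems(1)] by (metis le_neq_implies_less)
  then show ?case
  proof cases
    case leftover
    have le: "card K \<le> (L + 1) * l"
      by (rule leftover_card_le[OF less.prems(1)]) (fact leftover)+
    obtain p where p: "placement l K X p0 (M + card K * (2 ^ L * 2 ^ l)) p"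
      using place_leftover[OF finK less.prems(1-3)] by blast
    have "M + card K * (2 ^ L * 2 ^ l) \<le> M + card (covered K) + waste l L"
      unfolding waste_def using mult_right_mono[OF le, of "2 ^ L * 2 ^ l"] by linarith
    then have "{0..<int (M + card K * (2 ^ L * 2 ^ l))} \<subseteq> {0..<int (M + card (covered K) + waste l L)}"
      by (rule int_range_mono)
    then have p': "placement l K X p0 (M + card (covered K) + waste l L) p"
      using p unfolding placement_def by blast
    have "weight L K \<le> 2 ^ card K" by (rule weight_nonneg_le(2)[OF less.prems(1)])
    also have "\<dots> \<le> 2 ^ ((L + 1) * l)" using le by (intro power_increasing) auto
    finally have "weight L K / 2 ^ ((L + 1) * l) \<le> 1" by simp
    then have "separated_family l L K X p0 M {p}" using p' by (simp add: separated_family_def)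
    then show ?thesis by blast
  next
    case full
    define K' where "K' = K - {(i, l, E)}"
    have K: "K = insert (i, l, E) K'" and nin: "(i, l, E) \<notin> K'"
      using full by (auto simp: K'_def)
    have finK': "finite K'" using finK by (simp add: K'_def)
    let ?C = "cells (2 ^ i) (2 ^ l) E" and ?M = "M + 2 ^ i * 2 ^ l"
    have bC: "bcells (i, l, E) = ?C" by (simp add: bcells_def)
    note v = valid_insertD[OF less.prems(1)[unfolded K] nin, unfolded bC]
    have cd: "card ?C = 2 ^ i * 2 ^ l" and "i \<le> L" using validD[OF less.prems(1) full] by auto
    have covK: "X \<union> covered K = X \<union> ?C \<union> covered K'" by (auto simp: K covered_insert bC)
    have cardcov: "?M + card (covered K') = M + card (covered K)"
      using v(3) finite_covered[OF finK'] cd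
      by (simp add: K covered_insert bC card_Un_disjoint finite_cells)
    (* E' is E or its mirror image; the position of its cells in all p of the family is recorded
       in order to compare the two families afterwards. *)
    have branch: "\<exists>G. finite G \<and> (\<forall>p\<in>G. placement l K X p0 (M + card (covered K) + waste l L) p \<and>
        (\<forall>r<2 ^ i. \<forall>c<2 ^ l. p (E' r c) = int (M + r * 2 ^ l + c))) \<and>
        pairwise (separates (2 ^ l) (X \<union> covered K)) G \<and>
        weight L K' / 2 ^ ((L + 1) * l) \<le> real (card G)"
      if cE': "cells (2 ^ i) (2 ^ l) E' = ?C"
        and lE': "\<And>p. lays_out (2 ^ l) (2 ^ i) (2 ^ l) p E' \<Longrightarrow> lays_out (2 ^ l) (2 ^ i) (2 ^ l) p E" for E'
    proof -
      obtain q where q: "\<forall>x\<in>X. q x = p0 x" "\<forall>r<2 ^ i. \<forall>c<2 ^ l. q (E' r c) = int (M + r * 2 ^ l + c)"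
        "inj_on q (X \<union> ?C)" "q ` (X \<union> ?C) \<subseteq> {0..<int ?M}" "lays_out (2 ^ l) (2 ^ i) (2 ^ l) q E'"
        using append_block[OF less.prems(2,3), of "2 ^ i" "2 ^ l" E' "2 ^ l"] v(4) cd
        unfolding cE' by blast
      have occ: "int ?M - 1 \<in> q ` (X \<union> ?C)"
      proof (rule image_eqI)
        show "E' (2 ^ i - 1) (2 ^ l - 1) \<in> X \<union> ?C"
          using cellsI[of "2 ^ i - 1" "2 ^ i" "2 ^ l - 1" "2 ^ l" E'] cE' by simp
        have e: "(2 ^ i - 1) * 2 ^ l + (2 ^ l - 1) = 2 ^ i * 2 ^ l - (1::nat)"
          by (simp add: diff_mult_distrib)
        have "(2::nat) ^ i - 1 < 2 ^ i" "(2::nat) ^ l - 1 < 2 ^ l" by simp_all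
        from q(2)[rule_format, OF this]
        have "q (E' (2 ^ i - 1) (2 ^ l - 1)) = int (M + ((2 ^ i - 1) * 2 ^ l + (2 ^ l - 1)))"
          by (simp only: add.assoc)
        moreover have "(1::nat) \<le> 2 ^ i * 2 ^ l" by simp
        ultimately show "int ?M - 1 = q (E' (2 ^ i - 1) (2 ^ l - 1))"
          unfolding e by linarith
      qed
      have "card K' < card K" using nin finK' by (simp add: K)
      from less.hyps[OF this v(2) q(3,4) occ] obtain G where G: "separated_family l L K' (X \<union> ?C) q ?M G" by blast
      have "placement l K X p0 (M + card (covered K) + waste l L) p \<and>
        (\<forall>r<2 ^ i. \<forall>c<2 ^ l. p (E' r c) = int (M + r * 2 ^ l + c))" if "p \<in> G" for p
      proof
        have pl: "placement l K' (X \<union> ?C) q (M + card (covered K) + waste l L) p"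
          using G that unfolding separated_family_def cardcov by blast
        then have eq: "p x = q x" if "x \<in> X \<union> ?C" for x using that by (simp add: placement_def)
        have "lays_out (2 ^ l) (2 ^ i) (2 ^ l) p E'"
          using eq by (intro lays_out_cong[OF _ q(5)]) (auto simp: cE')
        then have "lays_out (2 ^ l) (2 ^ i) (2 ^ l) p E" by (rule lE')
        then show "placement l K X p0 (M + card (covered K) + waste l L) p"
          using pl eq q(1) unfolding placement_def covK by (simp add: K)
        show "\<forall>r<2 ^ i. \<forall>c<2 ^ l. p (E' r c) = int (M + r * 2 ^ l + c)"
          using eq q(2) cellsI[of _ "2 ^ i" _ "2 ^ l" E'] cE' by auto
      qed
      then show ?thesis using G unfolding separated_family_def covK by blast
    qed
    obtain G where G: "finite G" "pairwise (separates (2 ^ l) (X \<union> covered K)) G"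
      "weight L K' / 2 ^ ((L + 1) * l) \<le> real (card G)"
      "\<And>p. p \<in> G \<Longrightarrow> placement l K X p0 (M + card (covered K) + waste l L) p"
      "\<And>p. p \<in> G \<Longrightarrow> \<forall>r<2 ^ i. \<forall>c<2 ^ l. p (E r c) = int (M + r * 2 ^ l + c)"
      using branch[OF refl] by blast
    obtain H where H: "finite H" "pairwise (separates (2 ^ l) (X \<union> covered K)) H"
      "weight L K' / 2 ^ ((L + 1) * l) \<le> real (card H)"
      "\<And>p. p \<in> H \<Longrightarrow> placement l K X p0 (M + card (covered K) + waste l L) p"
      "\<And>p. p \<in> H \<Longrightarrow> \<forall>r<2 ^ i. \<forall>c<2 ^ l. p (mirror (2 ^ l) E r c) = int (M + r * 2 ^ l + c)"
      using branch[OF cells_mirror lays_out_mirror] by blast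
    (* w is the last element placed before the block. The pair of w and the top right cell of the
       block is at distance d if the block is appended as it is, and at distance 1 if mirrored. *)
    obtain w where w: "w \<in> X" "p0 w = int M - 1" using less.prems(4) by force
    let ?y = "E 0 (2 ^ l - 1)"
    have y: "?y \<in> X \<union> covered K"
      using cellsI[of 0 "2 ^ i" "2 ^ l - 1" "2 ^ l" E] by (simp add: covK)
    have "separates (2 ^ l) (X \<union> covered K) p q" if "p \<in> G" "q \<in> H" for p q
    proof -
      have "p w = int M - 1" "q w = int M - 1"
        using G(4)[OF that(1)] H(4)[OF that(2)] w by (auto simp: placement_def)
      moreover have "p ?y = int M + (2 ^ l - 1)"
        using G(5)[OF that(1)] by (simp add: of_nat_diff)
      moreover have "q ?y = int M"
        using H(5)[OF that(2), THEN spec, of 0] by (simp add: mirror_def)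
      ultimately have "\<bar>p w - p ?y\<bar> = int (2 ^ l)" "\<bar>q w - q ?y\<bar> = 1" by simp_all
      then show ?thesis unfolding separates_def using w(1) y by blast
    qed
    then have GH: "pairwise (separates (2 ^ l) (X \<union> covered K)) (G \<union> H)"
        "card (G \<union> H) = card G + card H"
      using separated_union[OF d G(1) H(1) G(2) H(2)] by blast+
    have "weight L K \<le> 2 * weight L K'"
      unfolding K weight_insert[OF finK' nin]
      using weight_factor_bounds[OF \<open>i \<le> L\<close>] weight_nonneg_le(1)[OF v(1)] by (intro mult_right_mono) auto
    then have "weight L K / 2 ^ ((L + 1) * l) \<le> 2 * weight L K' / 2 ^ ((L + 1) * l)"
      by (rule divide_right_mono) simp
    also have "\<dots> \<le> real (card (G \<union> H))" using G(3) H(3) unfolding GH(2) by simp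
    finally have "separated_family l L K X p0 M (G \<union> H)"
      unfolding separated_family_def using G(1,4) H(1,4) GH(1) by blast
    then show ?thesis by blast
  next
    case twins
    define K' where "K' = K - {(i, j, E), (i, j, F)}"
    have K: "K = insert (i, j, E) (insert (i, j, F) K')"
      and new: "(i, j, E) \<noteq> (i, j, F)" "(i, j, E) \<notin> K'" "(i, j, F) \<notin> K'"
      using twins by (auto simp: K'_def)
    have finK': "finite K'" using finK by (simp add: K'_def)
    have iL: "i \<le> L" using validD[OF less.prems(1) twins(1)] by auto
    have vK': "valid_blocks l L X K'"
      using less.prems(1) by (auto simp: K valid_blocks_def pairwise_insert covered_insert disjnt_def)
    define f where "f i = 2 - 2 ^ i / (2 ^ L :: real)" for i
    have wK: "weight L K = f i * f i * weight L K'"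
      using new finK' by (simp add: K weight_insert f_def)
    let ?P = "\<lambda>G g i'. finite G \<and> (\<forall>p\<in>G. placement l K X p0 (M + card (covered K) + waste l L) p \<and>
        \<bar>p (E (2 ^ i - 1) (2 ^ j - 1)) - p (F 0 (2 ^ j - 1))\<bar> = int g) \<and>
        pairwise (separates (2 ^ l) (X \<union> covered K)) G \<and>
        f i' * weight L K' / 2 ^ ((L + 1) * l) \<le> real (card G)"
    (* J is one of the two glued blocks, of height 2 ^ i', and g is the distance that it forces on the
       pair of cells by which the two ways of gluing are told apart. *)
    have branch: "\<exists>G. ?P G g i'"
      if shape: "i' \<le> L" "j' \<le> l" "i' + j' = Suc (i + j)"
        and J: "cells (2 ^ i') (2 ^ j') J = cells (2 ^ i) (2 ^ j) E \<union> cells (2 ^ i) (2 ^ j) F"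
        and lay: "\<And>p. lays_out (2 ^ l) (2 ^ i') (2 ^ j') p J \<Longrightarrow>
          lays_out (2 ^ l) (2 ^ i) (2 ^ j) p E \<and> lays_out (2 ^ l) (2 ^ i) (2 ^ j) p F \<and>
          \<bar>p (E (2 ^ i - 1) (2 ^ j - 1)) - p (F 0 (2 ^ j - 1))\<bar> = int g"
      for i' j' J g
    proof -
      note m = valid_merge[OF less.prems(1)[unfolded K] new shape J, folded K]
      have "card (insert (i', j', J) K') < card K" using new m(2) finK' by (simp add: K)
      from less.hyps[OF this m(1) less.prems(2-4)]
      obtain G where G: "separated_family l L (insert (i', j', J) K') X p0 M G" by blast
      have "placement l K X p0 (M + card (covered K) + waste l L) p \<and>
        \<bar>p (E (2 ^ i - 1) (2 ^ j - 1)) - p (F 0 (2 ^ j - 1))\<bar> = int g" if "p \<in> G" for p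
      proof -
        have pl: "placement l (insert (i', j', J) K') X p0 (M + card (covered K) + waste l L) p"
          using G that unfolding separated_family_def m(3) by blast
        then have "lays_out (2 ^ l) (2 ^ i') (2 ^ j') p J" by (simp add: placement_def)
        from lay[OF this] show ?thesis using placement_merge[OF pl _ _ m(3)[unfolded K]] K by blast
      qed
      then show ?thesis
        using G finK' m(2) unfolding separated_family_def m(3) f_def by (auto simp: weight_insert)
    qed
    obtain H where H: "?P H 1 i"
      using branch[of i "Suc j" "hjoin (2 ^ i) (2 ^ j) E F" 1]
        cells_hjoin[of "2 ^ i" "2 ^ j" E F] lays_out_hjoin[of "2 ^ l" "2 ^ i" "2 ^ j" _ E F] iL twins(4)
      by auto
    show ?thesis
    proof (cases "i < L")
      case True
      obtain G where G: "?P G (2 ^ l) (Suc i)"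
        using branch[of "Suc i" j "vjoin (2 ^ i) E F" "2 ^ l"]
          cells_vjoin[of "2 ^ i" "2 ^ j" E F] lays_out_vjoin[of "2 ^ l" "2 ^ i" "2 ^ j" _ E F]
          True twins(4) by auto
      have xy: "E (2 ^ i - 1) (2 ^ j - 1) \<in> X \<union> covered K" "F 0 (2 ^ j - 1) \<in> X \<union> covered K"
        using cellsI[of "2 ^ i - 1" "2 ^ i" "2 ^ j - 1" "2 ^ j" E]
          cellsI[of 0 "2 ^ i" "2 ^ j - 1" "2 ^ j" F]
        by (auto simp: K covered_insert bcells_def)
      have "separates (2 ^ l) (X \<union> covered K) p q" if "p \<in> G" "q \<in> H" for p q
      proof -
        have "\<bar>p (E (2 ^ i - 1) (2 ^ j - 1)) - p (F 0 (2 ^ j - 1))\<bar> = int (2 ^ l)"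
          "\<bar>q (E (2 ^ i - 1) (2 ^ j - 1)) - q (F 0 (2 ^ j - 1))\<bar> = 1"
          using G H that by (blast, force)
        then show ?thesis unfolding separates_def using xy by blast
      qed
      with G H have GH: "pairwise (separates (2 ^ l) (X \<union> covered K)) (G \<union> H)"
          "card (G \<union> H) = card G + card H"
        using separated_union[OF d] by blast+
      have "f i * f i \<le> f (Suc i) + f i" unfolding f_def by (rule weight_factor_square[OF iL])
      then have "weight L K \<le> (f (Suc i) + f i) * weight L K'"
        unfolding wK using weight_nonneg_le(1)[OF vK'] by (rule mult_right_mono)
      then have "weight L K / 2 ^ ((L + 1) * l) \<le> (f (Suc i) + f i) * weight L K' / 2 ^ ((L + 1) * l)"
        by (rule divide_right_mono) simp
      also have "\<dots> \<le> real (card (G \<union> H))"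
        using G H unfolding GH(2) by (simp add: distrib_right add_divide_distrib)
      finally have "separated_family l L K X p0 M (G \<union> H)"
        unfolding separated_family_def using G H GH(1) by blast
      then show ?thesis by blast
    next
      case False
      (* At the maximal height the weight is 1, so gluing side by side alone loses nothing. *)
      then have "f i = 1" using iL by (simp add: f_def)
      then have "separated_family l L K X p0 M H" using H wK by (simp add: separated_family_def)
      then show ?thesis by blast
    qed
  qed
qed

section \<open>The upper bound\<close>

definition even_entries :: "'a list \<Rightarrow> 'a set" where
  "even_entries xs = {xs ! i | i. i < length xs \<and> even i}"

lemma nth_in_even_entries:
  assumes "distinct xs" "i < length xs"
  shows "xs ! i \<in> even_entries xs \<longleftrightarrow> even i"
  using assms by (auto simp: even_entries_def nth_eq_iff_index_eq)

lemma at_distance_parity: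
  assumes "distinct xs" "at_distance d xs a b"
  shows "(a \<in> even_entries xs \<longleftrightarrow> b \<in> even_entries xs) \<longleftrightarrow> even d"
  using assms by (auto simp: at_distance_def nth_in_even_entries)

lemma neighbor_separated_even_entries:
  assumes "distinct xs" "distinct ys" "even (k - 1)" "neighbor_separated k xs ys"
  shows "even_entries xs \<noteq> even_entries ys"
proof
  assume eq: "even_entries xs = even_entries ys"
  obtain a b where
    "at_distance 1 xs a b \<and> at_distance (k - 1) ys a b \<or> at_distance 1 ys a b \<and> at_distance (k - 1) xs a b"
    using assms(4) by (auto simp: neighbor_separated_def)
  then show False
    using at_distance_parity[OF assms(1), of _ a b] at_distance_parity[OF assms(2), of _ a b]
      assms(3) odd_one unfolding eq by blast
qed

lemma finite_separated_cards:
  "finite {card F | F. F \<subseteq> permutations_of_set {1..n} \<and> pairwise (neighbor_separated k) F}"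
  by (rule finite_subset[of _ "card ` Pow (permutations_of_set {1..n})"]) auto

lemma max_separated_le:
  assumes "odd k"
  shows "max_separated n k \<le> 2 ^ n"
  unfolding max_separated_def
proof (rule Max.boundedI[OF finite_separated_cards])
  show "{card F | F. F \<subseteq> permutations_of_set {1..n} \<and> pairwise (neighbor_separated k) F} \<noteq> {}"
    using pairwise_empty by blast
next
  fix m assume "m \<in> {card F | F. F \<subseteq> permutations_of_set {1..n} \<and> pairwise (neighbor_separated k) F}"
  then obtain F where F: "F \<subseteq> permutations_of_set {1..n}" "pairwise (neighbor_separated k) F" "m = card F"
    by blast
  have "inj_on even_entries F"
  proof (rule inj_onI, rule ccontr)
    fix xs ys assume *: "xs \<in> F" "ys \<in> F" "even_entries xs = even_entries ys" "xs \<noteq> ys"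
    then have "distinct xs" "distinct ys" using F(1) by (auto dest: permutations_of_setD)
    then show False
      using neighbor_separated_even_entries[of xs ys k] pairwiseD[OF F(2)] * assms by auto
  qed
  moreover have "even_entries ` F \<subseteq> Pow {1..n}"
    using F(1) by (force simp: even_entries_def permutations_of_set_def)
  ultimately have "card F \<le> card (Pow {1..n})" by (intro card_inj_on_le) auto
  then show "m \<le> 2 ^ n" using F(3) by (simp add: card_Pow)
qed

section \<open>The lower bound\<close>

text \<open>
  The elements outside \<open>X\<close> fill the gaps in an arbitrary way.
\<close>

lemma placement_to_permutation:
  fixes p :: "'a \<Rightarrow> int"
  assumes "finite A" "X \<subseteq> A" "inj_on p X" "p ` X \<subseteq> {0..<int (card A)}"
  shows "\<exists>xs\<in>permutations_of_set A. \<forall>x\<in>X. xs ! nat (p x) = x"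
proof -
  let ?N = "card A" and ?q = "\<lambda>x. nat (p x)"
  have q: "inj_on ?q X" "?q ` X \<subseteq> {..<?N}"
    using assms(3,4) by (auto simp: inj_on_def nat_eq_iff image_subset_iff)
  have "card ({..<?N} - ?q ` X) = card (A - X)"
    using q assms(1,2) by (simp add: card_Diff_subset finite_subset card_image)
  then obtain h where h: "bij_betw h ({..<?N} - ?q ` X) (A - X)"
    using finite_same_card_bij assms(1) by blast
  define f where "f k = (if k \<in> ?q ` X then inv_into X ?q k else h k)" for k
  have "bij_betw (inv_into X ?q) (?q ` X) X"
    using q(1) by (simp add: bij_betw_imageI bij_betw_inv_into)
  then have f1: "bij_betw f (?q ` X) X" by (subst bij_betw_cong[of _ _ "inv_into X ?q"]) (auto simp: f_def)
  have f2: "bij_betw f ({..<?N} - ?q ` X) (A - X)"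
    using h by (subst bij_betw_cong[of _ _ h]) (auto simp: f_def)
  have "bij_betw f (?q ` X \<union> ({..<?N} - ?q ` X)) (X \<union> (A - X))"
    by (rule bij_betw_combine[OF f1 f2]) blast
  moreover have "?q ` X \<union> ({..<?N} - ?q ` X) = {..<?N}" "X \<union> (A - X) = A"
    using q(2) assms(2) by blast+
  ultimately have f: "bij_betw f {..<?N} A" by simp
  have "map f [0..<?N] \<in> permutations_of_set A"
    using f by (intro permutations_of_setI)
      (auto simp: distinct_map bij_betw_def lessThan_atLeast0)
  moreover have "map f [0..<?N] ! ?q x = x" if "x \<in> X" for x
  proof -
    have "?q x < ?N" using q(2) that by blast
    then show ?thesis using that inv_into_f_f[OF q(1) that] by (simp add: f_def)
  qed
  ultimately show ?thesis by blast
qed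

lemma at_distance_of_placement:
  assumes "xs \<in> permutations_of_set A" "\<forall>x\<in>X. xs ! nat (p x) = x" "p ` X \<subseteq> {0..<int (card A)}"
    and "x \<in> X" "y \<in> X" "\<bar>p x - p y\<bar> = int d"
  shows "at_distance d xs x y"
proof -
  have "length xs = card A" using assms(1) by (rule length_finite_permutations_of_set)
  moreover have "0 \<le> p x" "p x < int (card A)" "0 \<le> p y" "p y < int (card A)" using assms(3-5) by auto
  moreover have "nat (p y) = nat (p x) + d \<or> nat (p x) = nat (p y) + d"
    using assms(6) calculation by linarith
  ultimately show ?thesis unfolding at_distance_def using assms(2,4,5)
    by (intro exI[of _ "nat (p x)"] exI[of _ "nat (p y)"]) auto
qed

lemma card_placements_le_max_separated:
  assumes "l \<ge> 1" "X \<subseteq> {1..N}"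
    and G: "\<And>p. p \<in> G \<Longrightarrow> inj_on p X \<and> p ` X \<subseteq> {0..<int N}"
    and sep: "pairwise (separates (2 ^ l) X) G"
  shows "card G \<le> max_separated N (2 ^ l + 1)"
proof -
  have "\<exists>xs\<in>permutations_of_set {1..N}. \<forall>x\<in>X. xs ! nat (p x) = x" if "p \<in> G" for p
    using placement_to_permutation[of "{1..N}" X p] G[OF that] assms(2) by simp
  then obtain \<phi> where \<phi>: "\<And>p. p \<in> G \<Longrightarrow> \<phi> p \<in> permutations_of_set {1..N}"
    "\<And>p. p \<in> G \<Longrightarrow> \<forall>x\<in>X. \<phi> p ! nat (p x) = x" by metis
  have ns: "neighbor_separated (2 ^ l + 1) (\<phi> p) (\<phi> q)" if pq: "p \<in> G" "q \<in> G" "p \<noteq> q" for p q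
  proof -
    obtain x y where xy: "x \<in> X" "y \<in> X"
      "\<bar>p x - p y\<bar> = 1 \<and> \<bar>q x - q y\<bar> = int (2 ^ l) \<or> \<bar>p x - p y\<bar> = int (2 ^ l) \<and> \<bar>q x - q y\<bar> = 1"
      using pairwiseD[OF sep pq] unfolding separates_def by blast
    have "at_distance d (\<phi> g) x y" if "g \<in> G" "\<bar>g x - g y\<bar> = int d" for g d
      using at_distance_of_placement[OF \<phi>(1)[OF that(1)] \<phi>(2)[OF that(1)] _ xy(1,2) that(2)]
        G[OF that(1)] by simp
    from this[OF pq(1)] this[OF pq(2)] have
      "at_distance 1 (\<phi> p) x y \<and> at_distance (2 ^ l) (\<phi> q) x y \<or>
       at_distance 1 (\<phi> q) x y \<and> at_distance (2 ^ l) (\<phi> p) x y"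
      using xy(3) by fastforce
    moreover have "x \<noteq> y" using xy(3) by auto
    ultimately show ?thesis unfolding neighbor_separated_def by auto
  qed
  have "\<phi> p \<noteq> \<phi> q" if "p \<in> G" "q \<in> G" "p \<noteq> q" for p q
  proof -
    have "distinct (\<phi> p)" "distinct (\<phi> q)"
      using \<phi>(1) that(1,2) permutations_of_setD(2) by blast+
    from neighbor_separated_even_entries[OF this _ ns[OF that]] show ?thesis using assms(1) by auto
  qed
  then have inj: "inj_on \<phi> G" unfolding inj_on_def by blast
  have "pairwise (neighbor_separated (2 ^ l + 1)) (\<phi> ` G)"
    using ns by (auto simp: pairwise_def)
  moreover have "\<phi> ` G \<subseteq> permutations_of_set {1..N}" using \<phi>(1) by blast
  ultimately have "card (\<phi> ` G) \<le> max_separated N (2 ^ l + 1)"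
    unfolding max_separated_def by (intro Max_ge[OF finite_separated_cards]) blast
  then show ?thesis by (simp add: card_image[OF inj])
qed

text \<open>
  The process starts with $n$ single cells and one further element at position 0, which is needed
  because the orientation of an appended block is only visible relative to an element before it.
\<close>

lemma max_separated_ge:
  assumes "l \<ge> 1"
  shows "(2 - 1 / 2 ^ L) ^ n / 2 ^ ((L + 1) * l) \<le> real (max_separated (1 + n + waste l L) (2 ^ l + 1))"
proof -
  let ?b = "\<lambda>k::nat. (0::nat, 0::nat, \<lambda>(_::nat) (_::nat). k)"
  let ?K = "?b ` {2..n + 1}" and ?X = "{1::nat}" and ?p0 = "\<lambda>_::nat. 0::int"
  have b: "bcells (?b k) = {k}" for k by (auto simp: bcells_def cells_def)
  have c: "cells (Suc 0) (Suc 0) (\<lambda>(_::nat) (_::nat). k) = {k}" for k by (auto simp: cells_def)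
  have cov: "covered ?K = {2..n + 1}" by (auto simp: covered_def b)
  have inj: "inj_on ?b {2..n + 1}" by (auto simp: inj_on_def fun_eq_iff)
  have "valid_blocks l L ?X ?K"
    unfolding valid_blocks_def cov by (auto simp: pairwise_def b disjnt_def c)
  then obtain G where G: "separated_family l L ?K ?X ?p0 1 G"
    using family_exists[OF assms, of L ?X ?K ?p0 1] by auto
  have w: "weight L ?K = (2 - 1 / 2 ^ L) ^ n"
    unfolding weight_def by (subst prod.reindex[OF inj]) simp
  have X: "?X \<union> covered ?K = {1..n + 1}" unfolding cov by auto
  have cardK: "card (covered ?K) = n" unfolding cov by simp
  note G' = G[unfolded separated_family_def w X cardK]
  have "card G \<le> max_separated (1 + n + waste l L) (2 ^ l + 1)"
  proof (rule card_placements_le_max_separated[OF assms])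
    show "inj_on p {1..n + 1} \<and> p ` {1..n + 1} \<subseteq> {0..<int (1 + n + waste l L)}" if "p \<in> G" for p
      using G' that unfolding placement_def X by blast
    show "pairwise (separates (2 ^ l) {1..n + 1}) G" using G' by blast
    show "{1..n + 1} \<subseteq> {1..1 + n + waste l L}" by auto
  qed
  then have "real (card G) \<le> real (max_separated (1 + n + waste l L) (2 ^ l + 1))" by simp
  then show ?thesis using G' by (elim conjE) (rule order_trans)
qed

section \<open>The growth rate\<close>

theorem theorem1p5:
  fixes l :: nat
  assumes "l \<ge> 1"
  shows "(\<lambda>n. root n (real (max_separated n (2 ^ l + 1)))) \<longlonglongrightarrow> 2"
proof (rule order_tendstoI)
  let ?a = "\<lambda>n. max_separated n (2 ^ l + 1)"
  have upper: "root n (real (?a n)) \<le> 2" if "n > 0" for n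
  proof -
    have "real (?a n) \<le> 2 ^ n"
      using max_separated_le[of "2 ^ l + 1" n] assms by (simp flip: of_nat_le_iff)
    then have "root n (real (?a n)) \<le> root n (2 ^ n)" using that by simp
    then show ?thesis using that by (simp add: real_root_power_cancel)
  qed
  show "\<forall>\<^sub>F n in sequentially. root n (real (?a n)) < u" if "2 < u" for u
    by (rule eventually_mono[OF eventually_gt_at_top[of 0]]) (erule le_less_trans[OF upper that])
  show "\<forall>\<^sub>F n in sequentially. u < root n (real (?a n))" if u: "u < 2" for u
  proof -
    obtain L where L: "(1 / 2) ^ L < 2 - u" using real_arch_pow_inv[of "2 - u" "1 / 2"] u by auto
    define \<rho> :: real where "\<rho> = 2 - 1 / 2 ^ L"
    have "1 / 2 ^ L \<le> (1::real)" by simp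
    then have "\<rho> > 0" unfolding \<rho>_def by linarith
    have "u < \<rho>" using L by (simp add: \<rho>_def power_one_over)
    define C where "C = 1 + waste l L"
    define c where "c = 1 / (2 ^ ((L + 1) * l) * \<rho> ^ C)"
    have "c > 0" using \<open>\<rho> > 0\<close> by (simp add: c_def)
    have lower: "root n c * \<rho> \<le> root n (real (?a n))" if "n > 0" "n \<ge> C" for n
    proof -
      have "c * \<rho> ^ n = \<rho> ^ (n - C) / 2 ^ ((L + 1) * l)"
        using \<open>\<rho> > 0\<close> that by (simp add: c_def power_diff)
      also have "\<dots> \<le> real (?a (1 + (n - C) + waste l L))"
        unfolding \<rho>_def by (rule max_separated_ge[OF assms])
      also have "1 + (n - C) + waste l L = n" using that by (simp add: C_def)
      finally have "root n (c * \<rho> ^ n) \<le> root n (real (?a n))" using that by simp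
      then show ?thesis using that \<open>\<rho> > 0\<close> by (simp add: real_root_mult real_root_power_cancel)
    qed
    have "(\<lambda>n. root n c * \<rho>) \<longlonglongrightarrow> 1 * \<rho>"
      by (intro tendsto_intros LIMSEQ_root_const \<open>c > 0\<close>)
    then have "\<forall>\<^sub>F n in sequentially. u < root n c * \<rho>"
      using \<open>u < \<rho>\<close> by (auto dest: order_tendstoD(1))
    then show ?thesis
      using eventually_gt_at_top[of 0] eventually_ge_at_top[of C]
      by eventually_elim (rule less_le_trans[OF _ lower])
  qed
qed

end
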